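(* Suppose $\Omega\subseteq\Xi$ is closed under variable substitution. Then the relation $\perp^{\Omega}$ satisfies invariance, monotonicity, base monotonicity and finite character. In fact, $\perp^{\Omega}$ has strong finite character. Moreover, $A\perp^{\Omega}_BB$ and $A\perp^{\Omega}_AB$ hold for any sets $A$ and $B$.
   Context: $T$ is a complete consistent first-order theory (possibly many-sorted); we work in a big saturated model of $T$. All sets are small subsets of the big model; $BC$ means $B\cup C$. A tuple also denotes the set of its entries, and $\bar a\in A$ means that all entries of $\bar a$ lie in $A$. $(A,B,C)\equiv(A',B',C')$ means that some automorphism of the big model maps $A$ onto $A'$, $B$ onto $B'$ and $C$ onto $C'$. Writing a formula as $\varphi(\bar x)$ means that each of its free variables appears in $\bar x$. Inconsistency pairs. For a formula $\varphi(\bar x;\bar y)$ whose free variables are partitioned into two blocks, a formula $\psi(\bar y_0,\dots,\bar y_{k-1})$ (also written $\psi(\bar y_{<k})$; no parameters) is a $k$-inconsistency witness for $\varphi(\bar x;\bar y)$ if $\big(\bigwedge_{i<k}\varphi(\bar x;\bar y_i)\big)\wedge\psi(\bar y_{<k})$ is inconsistent. $\Xi$ is the set of all pairs $(\varphi(\bar x;\bar y),\psi(\bar y_{<k}))$, $k<\omega$, such that $\psi$ is a $k$-inconsistency witness for $\varphi$. Dividing. For $(\varphi,\psi)\in\Xi$, a formula $\varphi(\bar x;\bar b)$ $(\varphi,\psi)$-divides over a set $C$ if there is a sequence $(\bar b_i)_{i<\omega}$ such that each $\bar b_i$ realises $\operatorname{tp}(\bar b/C)$ and $\models\psi(\bar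 b_{i_0},\dots,\bar b_{i_{k-1}})$ for all $i_0<\dots<i_{k-1}<\omega$. A partial type $p(\bar x)$ $(\varphi,\psi)$-divides over $C$ if it contains a formula $\varphi(\bar x;\bar b)$ that $(\varphi,\psi)$-divides over $C$. A set $\Omega\subseteq\Xi$ is closed under variable substitution if whenever $(\varphi(\bar x;\bar y),\psi(\bar y_{<k}))\in\Omega$ and $\bar u,\bar v,\bar v_0,\dots,\bar v_{k-1}$ are tuples of variables of appropriate lengths and sorts (possibly with repetitions inside a tuple, but pairwise disjoint from each other), then $(\varphi(\bar u;\bar v),\psi(\bar v_{<k}))\in\Omega$. A partial type $\Omega$-divides over $C$ if it $(\varphi,\psi)$-divides over $C$ for some $(\varphi,\psi)\in\Omega$. Define $$A\perp^{\Omega}_CB\iff\text{there is no } \bar a\in A \text{ such that } \operatorname{tp}(\bar a/BC)\ \Omega\text{-divides over } C.$$ Properties of a ternary relation $\perp$: - (invariance) If $A\perp_CB$ and $(A',B',C')\equiv(A,B,C)$, then $A'\perp_{C'}B'$. - (monotonicity) If $A\perp_CB$, $A'\subseteq A$ and $B'\subseteq B$, then $A'\perp_CB'$. - (base monotonicity) If $D\subseteq C\subseteq B$ and $A\perp_DB$, then $A\perp_CB$. - (finite character) If $A_0\perp_CB$ for all finite $A_0\subseteq A$, then $A\perp_CB$. - (strong finite character) If $A\not\perp_CB$, then there are finite tuples $\bar a\in A$, $\bar b\in B$, $\bar c\in C$ and a formula $\varphi(\bar x,\bar y,\bar z)$ without parameters such that $\models\varphi(\bar a,\bar b,\bar c)$,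 and $\bar a'\not\perp_C\bar b$ for all $\bar a'$ satisfying $\models\varphi(\bar a',\bar b,\bar c)$. *)

theory Defs
  imports Main
begin

section \<open>Many-sorted first-order logic\<close>

text \<open>
  A symbol belongs to the signature iff it is mapped to some type, so signatures without function
  symbols or without relation symbols are covered. The sorts are the elements of the type \<open>'s\<close>.
\<close>

record ('s, 'f, 'r) signature =
  fun_type :: "'f \<Rightarrow> ('s list \<times> 's) option"
  rel_type :: "'r \<Rightarrow> 's list option"

text \<open>
  Bound variables are de Bruijn indices; free variables are named by elements of \<open>'v\<close>. Hence
  replacing free variables by free variables (or by parameters) is the map function of the
  datatype and never leads to capture. Formulas without parameters have \<open>'v = 's var\<close>, formulas
  with parameters have \<open>'v = 's var + 'm\<close>, where \<open>Inr m\<close> is the parameter \<open>m\<close>.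
\<close>

type_synonym 's var = "'s \<times> nat"

datatype (dead 'f, fv_tm: 'v) tm =
    Fv 'v
  | Bv nat
  | Fn 'f "('f, 'v) tm list"
  for map: rename_tm

datatype (dead 's, dead 'f, dead 'r, fv: 'v) fm =
    Eq "('f, 'v) tm" "('f, 'v) tm"
  | Rel 'r "('f, 'v) tm list"
  | Neg "('s, 'f, 'r, 'v) fm"
  | Conj "('s, 'f, 'r, 'v) fm" "('s, 'f, 'r, 'v) fm"
  | Exists 's "('s, 'f, 'r, 'v) fm"
  for map: rename

text \<open>Well-sortedness, given the sorts \<open>\<tau>\<close> of the free and \<open>\<Gamma>\<close> of the bound variables.\<close>

inductive wf_tm :: "('s, 'f, 'r) signature \<Rightarrow> ('v \<Rightarrow> 's) \<Rightarrow> 's list \<Rightarrow> ('f, 'v) tm \<Rightarrow> 's \<Rightarrow> bool"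
  for L \<tau> \<Gamma> where
  "wf_tm L \<tau> \<Gamma> (Fv v) (\<tau> v)"
| "n < length \<Gamma> \<Longrightarrow> wf_tm L \<tau> \<Gamma> (Bv n) (\<Gamma> ! n)"
| "fun_type L f = Some (ss, s) \<Longrightarrow> list_all2 (wf_tm L \<tau> \<Gamma>) ts ss \<Longrightarrow> wf_tm L \<tau> \<Gamma> (Fn f ts) s"

primrec wf_fm :: "('s, 'f, 'r) signature \<Rightarrow> ('v \<Rightarrow> 's) \<Rightarrow> 's list \<Rightarrow> ('s, 'f, 'r, 'v) fm \<Rightarrow> bool" where
  "wf_fm L \<tau> \<Gamma> (Eq t u) \<longleftrightarrow> (\<exists>s. wf_tm L \<tau> \<Gamma> t s \<and> wf_tm L \<tau> \<Gamma> u s)"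
| "wf_fm L \<tau> \<Gamma> (Rel r ts) \<longleftrightarrow> (\<exists>ss. rel_type L r = Some ss \<and> list_all2 (wf_tm L \<tau> \<Gamma>) ts ss)"
| "wf_fm L \<tau> \<Gamma> (Neg \<phi>) \<longleftrightarrow> wf_fm L \<tau> \<Gamma> \<phi>"
| "wf_fm L \<tau> \<Gamma> (Conj \<phi> \<psi>) \<longleftrightarrow> wf_fm L \<tau> \<Gamma> \<phi> \<and> wf_fm L \<tau> \<Gamma> \<psi>"
| "wf_fm L \<tau> \<Gamma> (Exists s \<phi>) \<longleftrightarrow> wf_fm L \<tau> (s # \<Gamma>) \<phi>"

definition formulas :: "('s, 'f, 'r) signature \<Rightarrow> ('s, 'f, 'r, 's var) fm set" where
  "formulas L = {\<phi>. wf_fm L fst [] \<phi>}"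

definition sentences :: "('s, 'f, 'r) signature \<Rightarrow> ('s, 'f, 'r, 's var) fm set" where
  "sentences L = {\<phi> \<in> formulas L. fv \<phi> = {}}"

text \<open>
  The universe of a structure is the type \<open>'m\<close>, the disjoint union of its sorts. As usual, no
  sort is empty.
\<close>

record ('s, 'f, 'r, 'm) struct =
  sort_of :: "'m \<Rightarrow> 's"
  fun_int :: "'f \<Rightarrow> 'm list \<Rightarrow> 'm"
  rel_int :: "'r \<Rightarrow> 'm list \<Rightarrow> bool"

definition is_structure :: "('s, 'f, 'r) signature \<Rightarrow> ('s, 'f, 'r, 'm) struct \<Rightarrow> bool" where
  "is_structure L M \<longleftrightarrow> surj (sort_of M) \<and>
    (\<forall>f ss s as. fun_type L f = Some (ss, s) \<and> map (sort_of M) as = ss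
        \<longrightarrow> sort_of M (fun_int M f as) = s)"

primrec eval :: "('s, 'f, 'r, 'm) struct \<Rightarrow> ('v \<Rightarrow> 'm) \<Rightarrow> 'm list \<Rightarrow> ('f, 'v) tm \<Rightarrow> 'm" where
  "eval M \<rho> e (Fv v) = \<rho> v"
| "eval M \<rho> e (Bv n) = e ! n"
| "eval M \<rho> e (Fn f ts) = fun_int M f (map (eval M \<rho> e) ts)"

primrec sat :: "('s, 'f, 'r, 'm) struct \<Rightarrow> ('v \<Rightarrow> 'm) \<Rightarrow> 'm list \<Rightarrow> ('s, 'f, 'r, 'v) fm \<Rightarrow> bool" where
  "sat M \<rho> e (Eq t u) \<longleftrightarrow> eval M \<rho> e t = eval M \<rho> e u"
| "sat M \<rho> e (Rel r ts) \<longleftrightarrow> rel_int M r (map (eval M \<rho> e) ts)"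
| "sat M \<rho> e (Neg \<phi>) \<longleftrightarrow> \<not> sat M \<rho> e \<phi>"
| "sat M \<rho> e (Conj \<phi> \<psi>) \<longleftrightarrow> sat M \<rho> e \<phi> \<and> sat M \<rho> e \<psi>"
| "sat M \<rho> e (Exists s \<phi>) \<longleftrightarrow> (\<exists>m. sort_of M m = s \<and> sat M \<rho> (m # e) \<phi>)"

definition assignment :: "('s, 'f, 'r, 'm) struct \<Rightarrow> ('s var \<Rightarrow> 'm) \<Rightarrow> bool" where
  "assignment M \<rho> \<longleftrightarrow> (\<forall>v. sort_of M (\<rho> v) = fst v)"

text \<open>
  \<open>M \<Turnstile> \<theta>(cs)\<close> for a formula \<open>\<theta>(zs)\<close> with parameters. If the tuple of variables \<open>zs\<close> has
  repetitions, then \<open>cs\<close> has to have equal entries at the corresponding places.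
\<close>

definition holds_par ::
  "('s, 'f, 'r, 'm) struct \<Rightarrow> ('s, 'f, 'r, 's var + 'm) fm \<Rightarrow> 's var list \<Rightarrow> 'm list \<Rightarrow> bool" where
  "holds_par M \<theta> zs cs \<longleftrightarrow> (\<exists>\<rho>. assignment M \<rho> \<and> map \<rho> zs = cs \<and> sat M (case_sum \<rho> id) [] \<theta>)"

definition holds ::
  "('s, 'f, 'r, 'm) struct \<Rightarrow> ('s, 'f, 'r, 's var) fm \<Rightarrow> 's var list \<Rightarrow> 'm list \<Rightarrow> bool" where
  "holds M \<phi> zs cs \<longleftrightarrow> (\<exists>\<rho>. assignment M \<rho> \<and> map \<rho> zs = cs \<and> sat M \<rho> [] \<phi>)"

definition par_formulas ::
  "('s, 'f, 'r) signature \<Rightarrow> ('s, 'f, 'r, 'm) struct \<Rightarrow> 's var set \<Rightarrow> 'm set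
    \<Rightarrow> ('s, 'f, 'r, 's var + 'm) fm set" where
  "par_formulas L M X D =
    {\<theta>. wf_fm L (case_sum fst (sort_of M)) [] \<theta> \<and> fv \<theta> \<subseteq> Inl ` X \<union> Inr ` D}"

text \<open>
  The type of a tuple is written in a fixed tuple of distinct variables of the right sorts.
\<close>

definition tp_vars :: "('s, 'f, 'r, 'm) struct \<Rightarrow> 'm list \<Rightarrow> 's var list" where
  "tp_vars M as = zip (map (sort_of M) as) [0..<length as]"

definition tp ::
  "('s, 'f, 'r) signature \<Rightarrow> ('s, 'f, 'r, 'm) struct \<Rightarrow> 'm list \<Rightarrow> 'm set
    \<Rightarrow> ('s, 'f, 'r, 's var + 'm) fm set" where
  "tp L M as D =
    {\<theta> \<in> par_formulas L M (set (tp_vars M as)) D. holds_par M \<theta> (tp_vars M as) as}"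

definition realises_tp ::
  "('s, 'f, 'r) signature \<Rightarrow> ('s, 'f, 'r, 'm) struct \<Rightarrow> 'm list \<Rightarrow> 'm list \<Rightarrow> 'm set \<Rightarrow> bool" where
  "realises_tp L M bs' bs D \<longleftrightarrow> map (sort_of M) bs' = map (sort_of M) bs \<and>
    (\<forall>\<theta> \<in> tp L M bs D. holds_par M \<theta> (tp_vars M bs) bs')"


section \<open>The big model\<close>

definition automorphism ::
  "('s, 'f, 'r) signature \<Rightarrow> ('s, 'f, 'r, 'm) struct \<Rightarrow> ('m \<Rightarrow> 'm) \<Rightarrow> bool" where
  "automorphism L M g \<longleftrightarrow> bij g \<and> (\<forall>a. sort_of M (g a) = sort_of M a) \<and>
    (\<forall>f ss s as. fun_type L f = Some (ss, s) \<and> map (sort_of M) as = ss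
        \<longrightarrow> g (fun_int M f as) = fun_int M f (map g as)) \<and>
    (\<forall>r ss as. rel_type L r = Some ss \<and> map (sort_of M) as = ss
        \<longrightarrow> (rel_int M r (map g as) \<longleftrightarrow> rel_int M r as))"

text \<open>
  A theory is understood to be closed under deduction, so completeness means that it contains each
  sentence or its negation. Consistency amounts to the existence of a model, which is part of
  \<open>big_model\<close> below.
\<close>

definition complete_theory ::
  "('s, 'f, 'r) signature \<Rightarrow> ('s, 'f, 'r, 's var) fm set \<Rightarrow> bool" where
  "complete_theory L T \<longleftrightarrow> T \<subseteq> sentences L \<and> (\<forall>\<phi> \<in> sentences L. \<phi> \<in> T \<or> Neg \<phi> \<in> T)"

definition is_model ::
  "('s, 'f, 'r) signature \<Rightarrow> ('s, 'f, 'r, 's var) fm set \<Rightarrow> ('s, 'f, 'r, 'm) struct \<Rightarrow> bool" where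
  "is_model L T M \<longleftrightarrow> is_structure L M \<and> (\<forall>\<phi> \<in> T. holds M \<phi> [] [])"

definition small :: "'k rel \<Rightarrow> 'm set \<Rightarrow> bool" where
  "small \<kappa> A \<longleftrightarrow> (card_of A, \<kappa>) \<in> ordLess"

definition saturated ::
  "('s, 'f, 'r) signature \<Rightarrow> 'k rel \<Rightarrow> ('s, 'f, 'r, 'm) struct \<Rightarrow> bool" where
  "saturated L \<kappa> M \<longleftrightarrow>
    (\<forall>D x p. small \<kappa> D \<and> p \<subseteq> par_formulas L M {x} D \<and>
      (\<forall>p0 \<subseteq> p. finite p0 \<longrightarrow> (\<exists>m. sort_of M m = fst x \<and> (\<forall>\<theta> \<in> p0. holds_par M \<theta> [x] [m])))
      \<longrightarrow> (\<exists>m. sort_of M m = fst x \<and> (\<forall>\<theta> \<in> p. holds_par M \<theta> [x] [m])))"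

definition strongly_homogeneous ::
  "('s, 'f, 'r) signature \<Rightarrow> 'k rel \<Rightarrow> ('s, 'f, 'r, 'm) struct \<Rightarrow> bool" where
  "strongly_homogeneous L \<kappa> M \<longleftrightarrow>
    (\<forall>D f. small \<kappa> D \<and> (\<forall>ds. set ds \<subseteq> D \<longrightarrow> tp L M (map f ds) {} = tp L M ds {})
      \<longrightarrow> (\<exists>g. automorphism L M g \<and> (\<forall>d \<in> D. g d = f d)))"

text \<open>
  A saturated model of cardinality \<open>\<kappa>\<close> (greater than the number of formulas) has these properties,
  with the sets of cardinality less than \<open>\<kappa>\<close> as small sets. The cardinal \<open>\<kappa>\<close> is not tied to the
  universe, because the models of \<open>T\<close> may be finite.
\<close>

definition big_model ::
  "('s, 'f, 'r) signature \<Rightarrow> ('s, 'f, 'r, 's var) fm set \<Rightarrow> 'k rel \<Rightarrow> ('s, 'f, 'r, 'm) struct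
    \<Rightarrow> bool" where
  "big_model L T \<kappa> M \<longleftrightarrow> is_model L T M \<and> Card_order \<kappa> \<and> small \<kappa> (formulas L) \<and>
    saturated L \<kappa> M \<and> strongly_homogeneous L \<kappa> M"


section \<open>Inconsistency pairs and dividing\<close>

text \<open>
  \<open>((\<phi>, xs, ys), (\<psi>, yss))\<close> stands for the pair of \<open>\<phi>(xs; ys)\<close> and \<open>\<psi>(yss ! 0, \<dots>, yss ! (k - 1))\<close>,
  where \<open>k = length yss\<close>.
\<close>

type_synonym ('s, 'f, 'r) inc_pair =
  "(('s, 'f, 'r, 's var) fm \<times> 's var list \<times> 's var list) \<times>
   (('s, 'f, 'r, 's var) fm \<times> 's var list list)"

definition pairwise_disjoint :: "'v list list \<Rightarrow> bool" where
  "pairwise_disjoint vss \<longleftrightarrow>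
    (\<forall>i j. i < j \<and> j < length vss \<longrightarrow> set (vss ! i) \<inter> set (vss ! j) = {})"

text \<open>
  Inconsistent means inconsistent with the complete theory of \<open>M\<close>, i.e. not realised in \<open>M\<close>.
  Tuples of variables may have repetitions, because substitution is allowed to introduce them.
\<close>

definition inconsistency_witness ::
  "('s, 'f, 'r, 'm) struct \<Rightarrow> ('s, 'f, 'r) inc_pair \<Rightarrow> bool" where
  "inconsistency_witness M = (\<lambda>((\<phi>, xs, ys), (\<psi>, yss)).
    \<not> (\<exists>as bss. length as = length xs \<and> length bss = length yss \<and>
        (\<forall>bs \<in> set bss. holds M \<phi> (xs @ ys) (as @ bs)) \<and>
        holds M \<psi> (concat yss) (concat bss)))"

definition Xi ::
  "('s, 'f, 'r) signature \<Rightarrow> ('s, 'f, 'r, 'm) struct \<Rightarrow> ('s, 'f, 'r) inc_pair set" where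
  "Xi L M = {((\<phi>, xs, ys), (\<psi>, yss)).
    \<phi> \<in> formulas L \<and> fv \<phi> \<subseteq> set xs \<union> set ys \<and> set xs \<inter> set ys = {} \<and>
    \<psi> \<in> formulas L \<and> fv \<psi> \<subseteq> set (concat yss) \<and> pairwise_disjoint (xs # yss) \<and>
    (\<forall>zs \<in> set yss. map fst zs = map fst ys) \<and>
    inconsistency_witness M ((\<phi>, xs, ys), (\<psi>, yss))}"

text \<open>
  Tuples \<open>us\<close>, \<open>vs\<close>, \<open>vss\<close> of appropriate lengths and sorts are the images of \<open>xs\<close>, \<open>ys\<close>, \<open>yss\<close>
  under sort-preserving maps \<open>\<sigma>\<close>, \<open>\<sigma>'\<close> of variables, which need not be injective. Two maps are used
  because nothing relates the variables \<open>ys\<close> of \<open>\<phi>\<close> to the variables \<open>yss\<close> of \<open>\<psi>\<close>.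
\<close>

definition closed_under_variable_substitution :: "('s, 'f, 'r) inc_pair set \<Rightarrow> bool" where
  "closed_under_variable_substitution \<Omega> \<longleftrightarrow>
    (\<forall>\<phi> xs ys \<psi> yss us vs vss \<sigma> \<sigma>'.
      ((\<phi>, xs, ys), (\<psi>, yss)) \<in> \<Omega> \<and>
      (\<forall>v. fst (\<sigma> v) = fst v) \<and> (\<forall>v. fst (\<sigma>' v) = fst v) \<and>
      us = map \<sigma> xs \<and> vs = map \<sigma> ys \<and> vss = map (map \<sigma>') yss \<and>
      pairwise_disjoint (us # vs # vss)
      \<longrightarrow> ((rename \<sigma> \<phi>, us, vs), (rename \<sigma>' \<psi>, vss)) \<in> \<Omega>)"

text \<open>\<open>\<phi>(xs; bs)\<close> \<open>(\<phi>, \<psi>)\<close>-divides over \<open>C\<close>; the list \<open>is\<close> is \<open>i\<^sub>0 < \<dots> < i\<^bsub>k-1\<^esub>\<close>.\<close>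

definition formula_divides ::
  "('s, 'f, 'r) signature \<Rightarrow> ('s, 'f, 'r, 'm) struct \<Rightarrow> ('s, 'f, 'r) inc_pair \<Rightarrow> 'm list \<Rightarrow> 'm set
    \<Rightarrow> bool" where
  "formula_divides L M = (\<lambda>((\<phi>, xs, ys), (\<psi>, yss)) bs C.
    \<exists>b :: nat \<Rightarrow> 'm list. (\<forall>i. realises_tp L M (b i) bs C) \<and>
      (\<forall>is. length is = length yss \<and> sorted_wrt (<) is
        \<longrightarrow> holds M \<psi> (concat yss) (concat (map b is))))"

text \<open>The formula \<open>\<phi>(xs; bs)\<close>, where \<open>bs = map \<eta> ys\<close>.\<close>

definition inst ::
  "'s var list \<Rightarrow> ('s var \<Rightarrow> 'm) \<Rightarrow> ('s, 'f, 'r, 's var) fm \<Rightarrow> ('s, 'f, 'r, 's var + 'm) fm" where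
  "inst ys \<eta> \<phi> = rename (\<lambda>v. if v \<in> set ys then Inr (\<eta> v) else Inl v) \<phi>"

definition pair_divides ::
  "('s, 'f, 'r) signature \<Rightarrow> ('s, 'f, 'r, 'm) struct \<Rightarrow> ('s, 'f, 'r) inc_pair
    \<Rightarrow> ('s, 'f, 'r, 's var + 'm) fm set \<Rightarrow> 'm set \<Rightarrow> bool" where
  "pair_divides L M = (\<lambda>((\<phi>, xs, ys), (\<psi>, yss)) p C.
    \<exists>\<eta>. (\<forall>v \<in> set ys. sort_of M (\<eta> v) = fst v) \<and> inst ys \<eta> \<phi> \<in> p \<and>
      formula_divides L M ((\<phi>, xs, ys), (\<psi>, yss)) (map \<eta> ys) C)"

definition Omega_divides ::
  "('s, 'f, 'r) signature \<Rightarrow> ('s, 'f, 'r, 'm) struct \<Rightarrow> ('s, 'f, 'r) inc_pair set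
    \<Rightarrow> ('s, 'f, 'r, 's var + 'm) fm set \<Rightarrow> 'm set \<Rightarrow> bool" where
  "Omega_divides L M \<Omega> p C \<longleftrightarrow> (\<exists>pr \<in> \<Omega>. pair_divides L M pr p C)"

text \<open>
  In all ternary relations the base is the second argument: \<open>R A C B\<close> stands for \<open>A \<bottom>\<^sub>C B\<close>.
\<close>

definition indep ::
  "('s, 'f, 'r) signature \<Rightarrow> ('s, 'f, 'r, 'm) struct \<Rightarrow> ('s, 'f, 'r) inc_pair set
    \<Rightarrow> 'm set \<Rightarrow> 'm set \<Rightarrow> 'm set \<Rightarrow> bool" where
  "indep L M \<Omega> A C B \<longleftrightarrow>
    \<not> (\<exists>as. set as \<subseteq> A \<and> Omega_divides L M \<Omega> (tp L M as (B \<union> C)) C)"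


section \<open>Properties of ternary relations between small sets\<close>

definition triple_equiv ::
  "('s, 'f, 'r) signature \<Rightarrow> ('s, 'f, 'r, 'm) struct \<Rightarrow> 'm set \<times> 'm set \<times> 'm set
    \<Rightarrow> 'm set \<times> 'm set \<times> 'm set \<Rightarrow> bool" where
  "triple_equiv L M = (\<lambda>(A, B, C) (A', B', C').
    \<exists>g. automorphism L M g \<and> g ` A = A' \<and> g ` B = B' \<and> g ` C = C')"

definition invariance ::
  "('s, 'f, 'r) signature \<Rightarrow> ('s, 'f, 'r, 'm) struct \<Rightarrow> 'k rel
    \<Rightarrow> ('m set \<Rightarrow> 'm set \<Rightarrow> 'm set \<Rightarrow> bool) \<Rightarrow> bool" where
  "invariance L M \<kappa> R \<longleftrightarrow>
    (\<forall>A B C A' B' C'. small \<kappa> A \<and> small \<kappa> B \<and> small \<kappa> C \<and> R A C B \<and>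
      triple_equiv L M (A', B', C') (A, B, C) \<longrightarrow> R A' C' B')"

definition monotonicity :: "'k rel \<Rightarrow> ('m set \<Rightarrow> 'm set \<Rightarrow> 'm set \<Rightarrow> bool) \<Rightarrow> bool" where
  "monotonicity \<kappa> R \<longleftrightarrow>
    (\<forall>A B C A' B'. small \<kappa> A \<and> small \<kappa> B \<and> small \<kappa> C \<and> R A C B \<and> A' \<subseteq> A \<and> B' \<subseteq> B
      \<longrightarrow> R A' C B')"

definition base_monotonicity :: "'k rel \<Rightarrow> ('m set \<Rightarrow> 'm set \<Rightarrow> 'm set \<Rightarrow> bool) \<Rightarrow> bool" where
  "base_monotonicity \<kappa> R \<longleftrightarrow>
    (\<forall>A B C D. small \<kappa> A \<and> small \<kappa> B \<and> D \<subseteq> C \<and> C \<subseteq> B \<and> R A D B \<longrightarrow> R A C B)"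

definition finite_character :: "'k rel \<Rightarrow> ('m set \<Rightarrow> 'm set \<Rightarrow> 'm set \<Rightarrow> bool) \<Rightarrow> bool" where
  "finite_character \<kappa> R \<longleftrightarrow>
    (\<forall>A B C. small \<kappa> A \<and> small \<kappa> B \<and> small \<kappa> C \<and>
      (\<forall>A0. finite A0 \<and> A0 \<subseteq> A \<longrightarrow> R A0 C B) \<longrightarrow> R A C B)"

definition strong_finite_character ::
  "('s, 'f, 'r) signature \<Rightarrow> ('s, 'f, 'r, 'm) struct \<Rightarrow> 'k rel
    \<Rightarrow> ('m set \<Rightarrow> 'm set \<Rightarrow> 'm set \<Rightarrow> bool) \<Rightarrow> bool" where
  "strong_finite_character L M \<kappa> R \<longleftrightarrow>
    (\<forall>A B C. small \<kappa> A \<and> small \<kappa> B \<and> small \<kappa> C \<and> \<not> R A C B \<longrightarrow>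
      (\<exists>as bs cs \<phi> xs ys zs. set as \<subseteq> A \<and> set bs \<subseteq> B \<and> set cs \<subseteq> C \<and>
        length xs = length as \<and> length ys = length bs \<and> length zs = length cs \<and>
        distinct (xs @ ys @ zs) \<and>
        \<phi> \<in> formulas L \<and> fv \<phi> \<subseteq> set (xs @ ys @ zs) \<and>
        holds M \<phi> (xs @ ys @ zs) (as @ bs @ cs) \<and>
        (\<forall>as'. holds M \<phi> (xs @ ys @ zs) (as' @ bs @ cs) \<longrightarrow> \<not> R (set as') C (set bs))))"

end

theory Submission
  imports Defs
begin

text \<open>
  Dividing of \<open>\<phi>(x;b)\<close> over \<open>C\<close> depends only on \<open>b\<close> and \<open>C\<close>, and it becomes easier when \<open>C\<close>
  shrinks; hence a failure of independence is witnessed by the single fact \<open>\<Turnstile> \<phi>(a,b)\<close>, which gives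
  strong finite character. If \<open>A \<subseteq> C\<close> or \<open>B \<subseteq> C\<close>, then every conjugate of \<open>b\<close> over \<open>C\<close> satisfies
  \<open>\<phi>(a,-)\<close>, so no sequence of conjugates can be inconsistent in the sense of \<open>\<psi>\<close>.
\<close>

section \<open>Renaming, coincidence and automorphisms\<close>

lemma eval_rename: "eval M \<rho> e (rename_tm f t) = eval M (\<rho> \<circ> f) e t"
  by (induction t) (simp_all add: o_def cong: map_cong)

text \<open>Quantifiers extend only \<open>e\<close>, and renaming touches only free names, so
  capture cannot occur. The map \<open>f\<close> may identify variables or turn them into
  parameters.\<close>

lemma sat_rename: "sat M \<rho> e (rename f \<phi>) \<longleftrightarrow> sat M (\<rho> \<circ> f) e \<phi>"
  by (induction \<phi> arbitrary: e) (simp_all add: eval_rename o_def cong: map_cong)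

lemma eval_cong: "(\<And>v. v \<in> fv_tm t \<Longrightarrow> \<rho> v = \<rho>' v) \<Longrightarrow> eval M \<rho> e t = eval M \<rho>' e t"
proof (induction t)
  case (Fn f ts)
  then have "map (eval M \<rho> e) ts = map (eval M \<rho>' e) ts"
    by (auto intro!: map_cong)
  then show ?case by (simp only: eval.simps)
qed simp_all

lemma sat_cong: "(\<And>v. v \<in> fv \<phi> \<Longrightarrow> \<rho> v = \<rho>' v) \<Longrightarrow> sat M \<rho> e \<phi> \<longleftrightarrow> sat M \<rho>' e \<phi>"
proof (induction \<phi> arbitrary: e)
  case (Eq t u)
  then have "eval M \<rho> e t = eval M \<rho>' e t" "eval M \<rho> e u = eval M \<rho>' e u"
    by (auto intro!: eval_cong)
  then show ?case by simp
next
  case (Rel r ts)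
  then have "map (eval M \<rho> e) ts = map (eval M \<rho>' e) ts"
    by (auto intro!: map_cong eval_cong)
  then show ?case by (simp only: sat.simps)
next
  case (Neg \<phi>)
  then show ?case by simp
next
  case (Conj \<phi> \<psi>)
  then have "sat M \<rho> e \<phi> = sat M \<rho>' e \<phi>" "sat M \<rho> e \<psi> = sat M \<rho>' e \<psi>"
    by auto
  then show ?case by simp
next
  case (Exists s \<phi>)
  then show ?case by simp
qed

section \<open>Preservation of well-sortedness and of truth\<close>

lemma wf_tm_rename:
  "wf_tm L \<tau> \<Gamma> t s \<Longrightarrow> (\<And>v. v \<in> fv_tm t \<Longrightarrow> \<tau>' (f v) = \<tau> v) \<Longrightarrow> wf_tm L \<tau>' \<Gamma> (rename_tm f t) s"
proof (induction rule: wf_tm.induct)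
  case (1 v)
  then show ?case using wf_tm.intros(1)[of L \<tau>' \<Gamma> "f v"] by simp
next
  case (2 n)
  then show ?case by (auto intro: wf_tm.intros)
next
  case (3 g ss s ts)
  \<comment> \<open>The induction hypothesis sits inside the \<open>list_all2\<close> premise;
    \<open>list.rel_mono_strong\<close> unpacks it entry by entry and supplies membership in
    \<open>ts\<close>, which brings in the assumption on free variables.\<close>
  have "list_all2 (wf_tm L \<tau>' \<Gamma>) (map (rename_tm f) ts) ss"
    unfolding list_all2_map1
    by (rule list.rel_mono_strong[OF 3(2)]) (use 3(3) in auto)
  with 3(1) show ?case by (auto intro: wf_tm.intros)
qed

lemma wf_fm_rename:
  "wf_fm L \<tau> \<Gamma> \<phi> \<Longrightarrow> (\<And>v. v \<in> fv \<phi> \<Longrightarrow> \<tau>' (f v) = \<tau> v) \<Longrightarrow> wf_fm L \<tau>' \<Gamma> (rename f \<phi>)"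
proof (induction \<phi> arbitrary: \<Gamma>)
  case (Eq t u)
  then show ?case by (fastforce intro: wf_tm_rename)
next
  case (Rel r ts)
  then obtain ss where ss: "rel_type L r = Some ss" "list_all2 (wf_tm L \<tau> \<Gamma>) ts ss" by auto
  have "list_all2 (wf_tm L \<tau>' \<Gamma>) (map (rename_tm f) ts) ss"
    unfolding list_all2_map1
    by (rule list.rel_mono_strong[OF ss(2)]) (use Rel(2) in \<open>auto intro: wf_tm_rename\<close>)
  with ss(1) show ?case by auto
qed auto

text \<open>Both claims go through one induction: \<open>g\<close> commutes with a function symbol
  only on arguments of the declared sorts, so the second claim at an application uses the first for
  its arguments.\<close>

lemma wf_eval:
  assumes "is_structure L M" "automorphism L M g"
    and "wf_tm L \<tau> \<Gamma> t s" "\<And>v. v \<in> fv_tm t \<Longrightarrow> sort_of M (\<rho> v) = \<tau> v" "map (sort_of M) e = \<Gamma>"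
  shows "sort_of M (eval M \<rho> e t) = s \<and> eval M (\<lambda>v. g (\<rho> v)) (map g e) t = g (eval M \<rho> e t)"
  using assms(3,4)
proof (induction rule: wf_tm.induct)
  case (2 n)
  then show ?case using assms(5) by auto
next
  case (3 f ss s ts)
  let ?as = "map (eval M \<rho> e) ts"
  have *: "list_all2 (\<lambda>t s. sort_of M (eval M \<rho> e t) = s \<and>
      eval M (\<lambda>v. g (\<rho> v)) (map g e) t = g (eval M \<rho> e t)) ts ss"
    by (rule list.rel_mono_strong[OF 3(2)]) (use 3(3) in auto)
  have sorts: "map (sort_of M) ?as = ss"
    using * by (induction ts ss rule: list_all2_induct) auto
  have "map (eval M (\<lambda>v. g (\<rho> v)) (map g e)) ts = map g ?as"
    using * by (induction ts ss rule: list_all2_induct) auto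
  then have "eval M (\<lambda>v. g (\<rho> v)) (map g e) (Fn f ts) = fun_int M f (map g ?as)"
    by (simp only: eval.simps)
  then show ?case
    using 3(1) sorts assms(1,2) by (simp add: is_structure_def automorphism_def)
qed simp

text \<open>Injectivity of \<open>g\<close> handles equations and surjectivity handles quantifiers.
  Well-sortedness enters because \<open>automorphism\<close> controls the symbols only on arguments
  of the declared sorts.\<close>

lemma sat_automorphism:
  assumes "is_structure L M" and g: "automorphism L M g"
  shows "wf_fm L \<tau> \<Gamma> \<phi> \<Longrightarrow> (\<And>v. v \<in> fv \<phi> \<Longrightarrow> sort_of M (\<rho> v) = \<tau> v) \<Longrightarrow> map (sort_of M) e = \<Gamma> \<Longrightarrow>
    sat M (\<lambda>v. g (\<rho> v)) (map g e) \<phi> \<longleftrightarrow> sat M \<rho> e \<phi>"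
proof (induction \<phi> arbitrary: \<Gamma> e)
  case (Eq t u)
  then obtain s where "wf_tm L \<tau> \<Gamma> t s" "wf_tm L \<tau> \<Gamma> u s" by auto
  then have "eval M (\<lambda>v. g (\<rho> v)) (map g e) t = g (eval M \<rho> e t)"
    "eval M (\<lambda>v. g (\<rho> v)) (map g e) u = g (eval M \<rho> e u)"
    using wf_eval[OF assms, of \<tau> \<Gamma> t s \<rho> e] wf_eval[OF assms, of \<tau> \<Gamma> u s \<rho> e] Eq.prems(2,3)
    by simp_all
  moreover have "inj g" using g by (simp add: automorphism_def bij_is_inj)
  ultimately show ?case by (simp add: inj_eq)
next
  case (Rel r ts)
  let ?as = "map (eval M \<rho> e) ts"
  obtain ss where r: "rel_type L r = Some ss" and ss: "list_all2 (wf_tm L \<tau> \<Gamma>) ts ss"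
    using Rel by auto
  have *: "list_all2 (\<lambda>t s. sort_of M (eval M \<rho> e t) = s \<and>
      eval M (\<lambda>v. g (\<rho> v)) (map g e) t = g (eval M \<rho> e t)) ts ss"
  proof (rule list.rel_mono_strong[OF ss])
    fix t s assume "t \<in> set ts" "wf_tm L \<tau> \<Gamma> t s"
    then show "sort_of M (eval M \<rho> e t) = s \<and> eval M (\<lambda>v. g (\<rho> v)) (map g e) t = g (eval M \<rho> e t)"
      using Rel.prems(2,3) by (intro wf_eval[OF assms, where \<tau> = \<tau>]) auto
  qed
  have "map (sort_of M) ?as = ss"
    using * by (induction ts ss rule: list_all2_induct) auto
  moreover have "map (eval M (\<lambda>v. g (\<rho> v)) (map g e)) ts = map g ?as"
    using * by (induction ts ss rule: list_all2_induct) auto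
  moreover have "rel_int M r (map g ?as) \<longleftrightarrow> rel_int M r ?as"
    using r g \<open>map (sort_of M) ?as = ss\<close> unfolding automorphism_def by blast
  ultimately show ?case by (simp only: sat.simps)
next
  case (Neg \<phi>)
  then show ?case by simp
next
  case (Conj \<phi> \<psi>)
  have "sat M (\<lambda>v. g (\<rho> v)) (map g e) \<phi> \<longleftrightarrow> sat M \<rho> e \<phi>"
    using Conj.prems by (intro Conj.IH(1)) auto
  moreover have "sat M (\<lambda>v. g (\<rho> v)) (map g e) \<psi> \<longleftrightarrow> sat M \<rho> e \<psi>"
    using Conj.prems by (intro Conj.IH(2)) auto
  ultimately show ?case by simp
next
  case (Exists s \<phi>)
  have IH: "sat M (\<lambda>v. g (\<rho> v)) (map g (m # e)) \<phi> \<longleftrightarrow> sat M \<rho> (m # e) \<phi>" if "sort_of M m = s" for m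
    using Exists.prems that by (intro Exists.IH[of "s # \<Gamma>"]) auto
  have sort: "sort_of M (g m) = sort_of M m" for m
    using g by (simp add: automorphism_def)
  \<comment> \<open>Every witness has the form \<open>g m\<close>, with \<open>m\<close> of the same
    sort, so the induction hypothesis applies to it.\<close>
  have surj: "(\<exists>m. Q m) \<longleftrightarrow> (\<exists>m. Q (g m))" for Q
    using g by (metis automorphism_def bij_is_surj surjD)
  have "sat M (\<lambda>v. g (\<rho> v)) (map g e) (Exists s \<phi>) \<longleftrightarrow>
      (\<exists>m. sort_of M (g m) = s \<and> sat M (\<lambda>v. g (\<rho> v)) (g m # map g e) \<phi>)"
    unfolding sat.simps by (rule surj)
  also have "\<dots> \<longleftrightarrow> sat M \<rho> e (Exists s \<phi>)"
    using IH by (auto simp: sort)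
  finally show ?case .
qed

text \<open>Each preservation condition for \<open>inv g\<close> is the one for \<open>g\<close> at
  the preimages of the arguments, which have the same sorts.\<close>

lemma automorphism_inv:
  assumes g: "automorphism L M g"
  shows "automorphism L M (inv g)"
proof -
  have bij: "bij g" and sort: "\<And>a. sort_of M (g a) = sort_of M a"
    using g by (auto simp: automorphism_def)
  have gi: "g (inv g a) = a" "inv g (g a) = a" for a
    using bij by (simp_all add: bij_is_surj surj_f_inv_f bij_is_inj)
  have sort': "sort_of M (inv g a) = sort_of M a" for a
    by (metis gi(1) sort)
  have map_gi: "map g (map (inv g) as) = as" for as
    by (simp add: gi o_def)
  have sorts: "map (sort_of M) (map (inv g) as) = map (sort_of M) as" for as
    by (simp add: sort')
  show ?thesis
    unfolding automorphism_def
  proof (intro conjI allI impI)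
    show "bij (inv g)" using bij by (rule bij_imp_bij_inv)
    show "sort_of M (inv g a) = sort_of M a" for a by (rule sort')
  next
    fix f ss s as assume "fun_type L f = Some (ss, s) \<and> map (sort_of M) as = ss"
    then have "g (fun_int M f (map (inv g) as)) = fun_int M f (map g (map (inv g) as))"
      using g sorts unfolding automorphism_def by metis
    then show "inv g (fun_int M f as) = fun_int M f (map (inv g) as)"
      unfolding map_gi by (metis gi(2))
  next
    fix r ss as assume "rel_type L r = Some ss \<and> map (sort_of M) as = ss"
    then have "rel_int M r (map g (map (inv g) as)) = rel_int M r (map (inv g) as)"
      using g sorts unfolding automorphism_def by metis
    then show "rel_int M r (map (inv g) as) = rel_int M r as"
      unfolding map_gi by simp
  qed
qed


section \<open>Types under automorphisms\<close>

lemma assignment_automorphism: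
  "automorphism L M g \<Longrightarrow> assignment M \<rho> \<Longrightarrow> assignment M (g \<circ> \<rho>)"
  by (simp add: automorphism_def assignment_def)

lemma holds_automorphism:
  assumes "is_structure L M" "automorphism L M g" "\<phi> \<in> formulas L" "holds M \<phi> zs cs"
  shows "holds M \<phi> zs (map g cs)"
proof -
  obtain \<rho> where \<rho>: "assignment M \<rho>" "map \<rho> zs = cs" "sat M \<rho> [] \<phi>"
    using assms(4) by (auto simp: holds_def)
  have "wf_fm L fst [] \<phi>" using assms(3) by (simp add: formulas_def)
  from sat_automorphism[OF assms(1,2) this, of \<rho> "[]"] \<rho> have "sat M (g \<circ> \<rho>) [] \<phi>"
    by (auto simp: assignment_def comp_def)
  then show ?thesis
    using assignment_automorphism[OF assms(2) \<rho>(1)] \<rho>(2) unfolding holds_def by auto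
qed

lemma holds_par_automorphism:
  assumes "is_structure L M" "automorphism L M g"
    and "wf_fm L (case_sum fst (sort_of M)) [] \<theta>" "holds_par M \<theta> zs cs"
  shows "holds_par M (rename (map_sum id g) \<theta>) zs (map g cs)"
proof -
  obtain \<rho> where \<rho>: "assignment M \<rho>" "map \<rho> zs = cs" "sat M (case_sum \<rho> id) [] \<theta>"
    using assms(4) by (auto simp: holds_par_def)
  have "sat M (g \<circ> case_sum \<rho> id) [] \<theta>"
    unfolding comp_def
    using sat_automorphism[OF assms(1,2,3), where \<rho> = "case_sum \<rho> id" and e = "[]"] \<rho>
    by (simp add: assignment_def split: sum.splits)
  \<comment> \<open>Applying \<open>g\<close> to all values amounts to moving the assignment by
    \<open>g\<close> and replacing each parameter by its image.\<close>
  also have "g \<circ> case_sum \<rho> id = case_sum (g \<circ> \<rho>) id \<circ> map_sum id g"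
    by (auto split: sum.splits)
  finally have "sat M (case_sum (g \<circ> \<rho>) id) [] (rename (map_sum id g) \<theta>)"
    by (simp only: sat_rename)
  then show ?thesis
    using assignment_automorphism[OF assms(2) \<rho>(1)] \<rho>(2) unfolding holds_par_def by auto
qed

text \<open>Only sorts and positions enter \<open>tp_vars\<close>; hence a tuple and its images
  under automorphisms have types in the same variables.\<close>

lemma tp_vars_cong: "map (sort_of M) as = map (sort_of M) bs \<Longrightarrow> tp_vars M as = tp_vars M bs"
  using map_eq_imp_length_eq by (fastforce simp: tp_vars_def)

lemma map_sort_automorphism:
  "automorphism L M g \<Longrightarrow> map (sort_of M) (map g as) = map (sort_of M) as"
  by (simp add: automorphism_def)

lemma tp_automorphism:
  assumes M: "is_structure L M" and g: "automorphism L M g" and \<theta>: "\<theta> \<in> tp L M as D"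
  shows "rename (map_sum id g) \<theta> \<in> tp L M (map g as) (g ` D)"
proof -
  have vars: "tp_vars M (map g as) = tp_vars M as"
    using map_sort_automorphism[OF g] by (rule tp_vars_cong)
  have \<theta>': "wf_fm L (case_sum fst (sort_of M)) [] \<theta>"
      "fv \<theta> \<subseteq> Inl ` set (tp_vars M as) \<union> Inr ` D" "holds_par M \<theta> (tp_vars M as) as"
    using \<theta> by (auto simp: tp_def par_formulas_def)
  have "wf_fm L (case_sum fst (sort_of M)) [] (rename (map_sum id g) \<theta>)"
    using \<theta>'(1)
    by (rule wf_fm_rename) (use g in \<open>auto simp: automorphism_def split: sum.splits\<close>)
  moreover have "fv (rename (map_sum id g) \<theta>) \<subseteq> Inl ` set (tp_vars M as) \<union> Inr ` g ` D"
    using \<theta>'(2) by (force simp: fm.set_map)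
  ultimately show ?thesis
    using holds_par_automorphism[OF M g \<theta>'(1,3)] by (simp add: tp_def par_formulas_def vars)
qed

text \<open>A formula in the type of \<open>map g bs\<close> is pulled back by \<open>inv g\<close>
  into the type of \<open>bs\<close>, where \<open>bs'\<close> satisfies it; pushing it forward by
  \<open>g\<close> restores the original formula.\<close>

lemma realises_tp_automorphism:
  assumes M: "is_structure L M" and g: "automorphism L M g" and b: "realises_tp L M bs' bs C"
  shows "realises_tp L M (map g bs') (map g bs) (g ` C)"
  unfolding realises_tp_def
proof (intro conjI ballI)
  show "map (sort_of M) (map g bs') = map (sort_of M) (map g bs)"
    using b unfolding map_sort_automorphism[OF g] by (simp add: realises_tp_def)
next
  fix \<theta> assume \<theta>: "\<theta> \<in> tp L M (map g bs) (g ` C)"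
  have bij: "bij g" using g by (simp add: automorphism_def)
  have inv: "inv g \<circ> g = id" "g \<circ> inv g = id"
    using bij by (simp_all add: bij_is_inj bij_is_surj flip: surj_iff)
  let ?\<theta> = "rename (map_sum id (inv g)) \<theta>"
  have "map (inv g) (map g bs) = bs" "inv g ` g ` C = C"
    using inv(1) by (simp_all add: image_comp)
  then have \<theta>': "?\<theta> \<in> tp L M bs C"
    using tp_automorphism[OF M automorphism_inv[OF g] \<theta>] by simp
  then have "wf_fm L (case_sum fst (sort_of M)) [] ?\<theta>" "holds_par M ?\<theta> (tp_vars M bs) bs'"
    using b by (auto simp: realises_tp_def tp_def par_formulas_def)
  then have "holds_par M (rename (map_sum id g) ?\<theta>) (tp_vars M bs) (map g bs')"
    by (rule holds_par_automorphism[OF M g])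
  moreover have "rename (map_sum id g) ?\<theta> = \<theta>"
    by (simp add: fm.map_comp map_sum.comp inv map_sum.id fm.map_id)
  ultimately show "holds_par M \<theta> (tp_vars M (map g bs)) (map g bs')"
    using tp_vars_cong[OF map_sort_automorphism[OF g]] by metis
qed

text \<open>Applied to an instance that belongs to a type, this tells where the occurring variables
  go: to variables of the type or to its parameter set.\<close>

lemma fv_inst_subsetD:
  assumes "fv (inst ys \<eta> \<phi>) \<subseteq> Inl ` X \<union> Inr ` D" "v \<in> fv \<phi>"
  shows "v \<notin> set ys \<Longrightarrow> v \<in> X" "v \<in> set ys \<Longrightarrow> \<eta> v \<in> D"
proof -
  have "(if v \<in> set ys then Inr (\<eta> v) else Inl v) \<in> fv (inst ys \<eta> \<phi>)"
    using assms(2) by (simp add: inst_def fm.set_map)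
  then have *: "(if v \<in> set ys then Inr (\<eta> v) else Inl v) \<in> Inl ` X \<union> Inr ` D"
    using assms(1) by blast
  show "v \<notin> set ys \<Longrightarrow> v \<in> X" "v \<in> set ys \<Longrightarrow> \<eta> v \<in> D"
    using * by auto
qed

section \<open>Failure of independence unfolded, and invariance\<close>

lemma indep_iff:
  "indep L M \<Omega> A C B \<longleftrightarrow>
    \<not> (\<exists>as \<phi> xs ys \<psi> yss \<eta>. set as \<subseteq> A \<and> ((\<phi>, xs, ys), (\<psi>, yss)) \<in> \<Omega> \<and>
      (\<forall>v \<in> set ys. sort_of M (\<eta> v) = fst v) \<and> inst ys \<eta> \<phi> \<in> tp L M as (B \<union> C) \<and>
      formula_divides L M ((\<phi>, xs, ys), (\<psi>, yss)) (map \<eta> ys) C)"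
  by (simp add: indep_def Omega_divides_def pair_divides_def Bex_def split_paired_Ex)

lemma indepI:
  assumes "\<And>as \<phi> xs ys \<psi> yss \<eta>. set as \<subseteq> A \<Longrightarrow> ((\<phi>, xs, ys), (\<psi>, yss)) \<in> \<Omega> \<Longrightarrow>
    (\<And>v. v \<in> set ys \<Longrightarrow> sort_of M (\<eta> v) = fst v) \<Longrightarrow> inst ys \<eta> \<phi> \<in> tp L M as (B \<union> C) \<Longrightarrow>
    formula_divides L M ((\<phi>, xs, ys), (\<psi>, yss)) (map \<eta> ys) C \<Longrightarrow> False"
  shows "indep L M \<Omega> A C B"
  using assms unfolding indep_iff by blast

lemma indepD:
  assumes "indep L M \<Omega> A C B" "set as \<subseteq> A" "((\<phi>, xs, ys), (\<psi>, yss)) \<in> \<Omega>"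
    and "\<And>v. v \<in> set ys \<Longrightarrow> sort_of M (\<eta> v) = fst v" "inst ys \<eta> \<phi> \<in> tp L M as (B \<union> C)"
    and "formula_divides L M ((\<phi>, xs, ys), (\<psi>, yss)) (map \<eta> ys) C"
  shows False
  using assms unfolding indep_iff by blast

lemma formula_dividesE:
  assumes "formula_divides L M ((\<phi>, xs, ys), (\<psi>, yss)) bs C"
  obtains b :: "nat \<Rightarrow> 'm list" where "\<And>i. realises_tp L M (b i) bs C"
    "\<And>is. length is = length yss \<Longrightarrow> sorted_wrt (<) is \<Longrightarrow>
      holds M \<psi> (concat yss) (concat (map b is))"
  using assms unfolding formula_divides_def prod.case by blast

text \<open>The automorphism runs from the primed triple to the unprimed one, so a dividing instance
  against the former is carried forward by \<open>g\<close> to one against the latter, together with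
  its sequence of conjugates.\<close>

lemma invariance_indep:
  assumes M: "is_structure L M" and \<Omega>: "\<Omega> \<subseteq> Xi L M"
  shows "invariance L M \<kappa> (indep L M \<Omega>)"
  unfolding invariance_def
proof (intro allI impI)
  fix A B C A' B' C'
  assume "small \<kappa> A \<and> small \<kappa> B \<and> small \<kappa> C \<and> indep L M \<Omega> A C B \<and>
    triple_equiv L M (A', B', C') (A, B, C)"
  then obtain g where ind: "indep L M \<Omega> A C B" and g: "automorphism L M g"
      and img: "g ` A' = A" "g ` B' = B" "g ` C' = C"
    by (auto simp: triple_equiv_def)
  show "indep L M \<Omega> A' C' B'"
  proof (rule indepI)
    fix as \<phi> xs ys \<psi> yss \<eta>
    assume as: "set as \<subseteq> A'" and pr: "((\<phi>, xs, ys), (\<psi>, yss)) \<in> \<Omega>"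
      and \<eta>: "\<And>v. v \<in> set ys \<Longrightarrow> sort_of M (\<eta> v) = fst v"
      and tp: "inst ys \<eta> \<phi> \<in> tp L M as (B' \<union> C')"
      and div: "formula_divides L M ((\<phi>, xs, ys), (\<psi>, yss)) (map \<eta> ys) C'"
    obtain b :: "nat \<Rightarrow> _" where b: "\<And>i. realises_tp L M (b i) (map \<eta> ys) C'"
      and \<psi>: "\<And>is. length is = length yss \<Longrightarrow> sorted_wrt (<) is \<Longrightarrow>
        holds M \<psi> (concat yss) (concat (map b is))"
      using formula_dividesE[OF div] by blast
    \<comment> \<open>\<open>Xi\<close> guarantees that \<open>\<psi>\<close> is a well-sorted
      formula without parameters, so \<open>g\<close> preserves its truth along the
      sequence.\<close>
    have \<psi>_formula: "\<psi> \<in> formulas L" using pr \<Omega> by (auto simp: Xi_def)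
    show False
    proof (rule indepD[OF ind _ pr])
      show "set (map g as) \<subseteq> A" using as img by auto
      show "sort_of M ((g \<circ> \<eta>) v) = fst v" if "v \<in> set ys" for v
        using \<eta>[OF that] g by (simp add: automorphism_def)
      have "rename (map_sum id g) (inst ys \<eta> \<phi>) = inst ys (g \<circ> \<eta>) \<phi>"
        by (simp add: inst_def fm.map_comp o_def if_distrib cong: if_cong)
      then show "inst ys (g \<circ> \<eta>) \<phi> \<in> tp L M (map g as) (B \<union> C)"
        using tp_automorphism[OF M g tp] by (simp add: image_Un img)
      have "realises_tp L M (map g (b i)) (map (g \<circ> \<eta>) ys) C" for i
        using realises_tp_automorphism[OF M g b[of i]] by (simp add: img)
      moreover have "holds M \<psi> (concat yss) (concat (map (\<lambda>i. map g (b i)) is))"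
        if "length is = length yss" "sorted_wrt (<) is" for "is" :: "nat list"
        using holds_automorphism[OF M g \<psi>_formula \<psi>[OF that]] by (simp add: map_concat comp_def)
      ultimately show "formula_divides L M ((\<phi>, xs, ys), (\<psi>, yss)) (map (g \<circ> \<eta>) ys) C"
        unfolding formula_divides_def prod.case by (intro exI[of _ "\<lambda>i. map g (b i)"]) auto
    qed
  qed
qed


section \<open>Monotonicity and finite character\<close>

lemma tp_mono: "D \<subseteq> D' \<Longrightarrow> tp L M as D \<subseteq> tp L M as D'"
  unfolding tp_def par_formulas_def by blast

text \<open>A type over the larger set contains the type over the smaller one, so the same sequence
  of realisations works for the smaller base.\<close>

lemma formula_divides_antimono:
  "C \<subseteq> C' \<Longrightarrow> formula_divides L M pr bs C' \<Longrightarrow> formula_divides L M pr bs C"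
  unfolding formula_divides_def realises_tp_def using tp_mono[of C C' L M bs]
  by (auto split: prod.splits) blast

text \<open>The base stays the same, so the dividing instance and its sequence are kept; the
  instance only has to be found in the type over more parameters.\<close>

lemma monotonicity_indep: "monotonicity \<kappa> (indep L M \<Omega>)"
  unfolding monotonicity_def
proof (intro allI impI)
  fix A B C A' B'
  assume *: "small \<kappa> A \<and> small \<kappa> B \<and> small \<kappa> C \<and> indep L M \<Omega> A C B \<and> A' \<subseteq> A \<and> B' \<subseteq> B"
  then have ind: "indep L M \<Omega> A C B" by blast
  have tp: "tp L M as (B' \<union> C) \<subseteq> tp L M as (B \<union> C)" for as
    using * by (intro tp_mono) blast
  show "indep L M \<Omega> A' C B'"
  proof (rule indepI)
    fix as \<phi> xs ys \<psi> yss \<eta>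
    assume "set as \<subseteq> A'" and pr: "((\<phi>, xs, ys), (\<psi>, yss)) \<in> \<Omega>"
      and \<eta>: "\<And>v. v \<in> set ys \<Longrightarrow> sort_of M (\<eta> v) = fst v"
      and "inst ys \<eta> \<phi> \<in> tp L M as (B' \<union> C)"
      and div: "formula_divides L M ((\<phi>, xs, ys), (\<psi>, yss)) (map \<eta> ys) C"
    then have "set as \<subseteq> A" "inst ys \<eta> \<phi> \<in> tp L M as (B \<union> C)"
      using * tp by blast+
    from indepD[OF ind this(1) pr \<eta> this(2) div] show False .
  qed
qed

text \<open>Both \<open>B \<union> C\<close> and \<open>B \<union> D\<close> equal \<open>B\<close>,
  so the type is unchanged, and dividing over \<open>C\<close> passes down to
  \<open>D\<close>.\<close>

lemma base_monotonicity_indep: "base_monotonicity \<kappa> (indep L M \<Omega>)"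
  unfolding base_monotonicity_def
proof (intro allI impI)
  fix A B C D
  assume *: "small \<kappa> A \<and> small \<kappa> B \<and> D \<subseteq> C \<and> C \<subseteq> B \<and> indep L M \<Omega> A D B"
  then have ind: "indep L M \<Omega> A D B" and sub: "D \<subseteq> C" and Un: "B \<union> C = B \<union> D" by auto
  show "indep L M \<Omega> A C B"
  proof (rule indepI)
    fix as \<phi> xs ys \<psi> yss \<eta>
    assume as: "set as \<subseteq> A" and pr: "((\<phi>, xs, ys), (\<psi>, yss)) \<in> \<Omega>"
      and \<eta>: "\<And>v. v \<in> set ys \<Longrightarrow> sort_of M (\<eta> v) = fst v"
      and tp: "inst ys \<eta> \<phi> \<in> tp L M as (B \<union> C)"
      and div: "formula_divides L M ((\<phi>, xs, ys), (\<psi>, yss)) (map \<eta> ys) C"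
    from indepD[OF ind as pr \<eta> tp[unfolded Un] formula_divides_antimono[OF sub div]] show False .
  qed
qed

text \<open>A failure involves a single tuple \<open>as\<close>, so it already occurs for the finite
  set \<open>set as\<close>.\<close>

lemma finite_character_indep: "finite_character \<kappa> (indep L M \<Omega>)"
  unfolding finite_character_def indep_def by (meson List.finite_set subset_refl)

section \<open>Strong finite character\<close>

lemma tp_vars_simps [simp]:
  "length (tp_vars M as) = length as"
  "i < length as \<Longrightarrow> tp_vars M as ! i = (sort_of M (as ! i), i)"
  by (simp_all add: tp_vars_def)

lemma distinct_tp_vars: "distinct (tp_vars M as)"
  by (auto simp: distinct_conv_nth)

text \<open>The required formula is \<open>\<phi>\<close> with \<open>ys\<close> moved by
  \<open>\<sigma>\<close>. Every \<open>as'\<close> satisfying it has the same instance in its type,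
  and the dividing of that instance does not mention \<open>as\<close>.\<close>

lemma strong_finite_character_indep:
  assumes \<Omega>: "\<Omega> \<subseteq> Xi L M"
  shows "strong_finite_character L M \<kappa> (indep L M \<Omega>)"
  unfolding strong_finite_character_def
proof (intro allI impI)
  fix A B C assume "small \<kappa> A \<and> small \<kappa> B \<and> small \<kappa> C \<and> \<not> indep L M \<Omega> A C B"
  then obtain as \<phi> xs ys \<psi> yss \<eta> where as: "set as \<subseteq> A" and pr: "((\<phi>, xs, ys), (\<psi>, yss)) \<in> \<Omega>"
      and \<eta>: "\<And>v. v \<in> set ys \<Longrightarrow> sort_of M (\<eta> v) = fst v"
      and tp: "inst ys \<eta> \<phi> \<in> tp L M as (B \<union> C)"
      and div: "formula_divides L M ((\<phi>, xs, ys), (\<psi>, yss)) (map \<eta> ys) C"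
    using indepI[of A \<Omega> M L B C] by blast
  have \<phi>: "wf_fm L fst [] \<phi>" using pr \<Omega> by (auto simp: Xi_def formulas_def)
  let ?N = "length as"
  \<comment> \<open>The shift keeps \<open>ys\<close> apart from \<open>tp_vars M as\<close>. Variables of \<open>ys\<close> not occurring in \<open>\<phi>\<close> are dropped,
    because their values under \<open>\<eta>\<close> may lie outside \<open>B \<union> C\<close>.\<close>
  define \<sigma> where "\<sigma> = (\<lambda>v :: 'a var. if v \<in> set ys then (fst v, snd v + ?N) else v)"
  have inj: "inj_on \<sigma> (set ys)"
    by (auto simp: \<sigma>_def inj_on_def prod_eq_iff)
  \<comment> \<open>The variables of the new formula must be distinct, whereas \<open>ys\<close> may
    repeat some. A value lying in both \<open>B\<close> and \<open>C\<close> is counted in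
    \<open>vB\<close>.\<close>
  define vs where "vs = filter (\<lambda>v. v \<in> fv \<phi>) (remdups ys)"
  define vB where "vB = filter (\<lambda>v. \<eta> v \<in> B) vs"
  define vC where "vC = filter (\<lambda>v. \<eta> v \<notin> B) vs"
  have set_vs: "set vB \<union> set vC = set ys \<inter> fv \<phi>" "set vB \<inter> set vC = {}"
    by (auto simp: vB_def vC_def vs_def)
  let ?xs = "tp_vars M as"
  have small_index: "snd v < ?N" if "v \<in> set ?xs" for v
    using that by (auto simp: in_set_conv_nth)
  have fv_inst: "fv (inst ys \<eta> \<phi>) \<subseteq> Inl ` set ?xs \<union> Inr ` (B \<union> C)"
    and wf_inst: "wf_fm L (case_sum fst (sort_of M)) [] (inst ys \<eta> \<phi>)"
    and holds_inst: "holds_par M (inst ys \<eta> \<phi>) ?xs as"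
    using tp by (auto simp: tp_def par_formulas_def)
  have fv_x: "v \<in> set ?xs" if "v \<in> fv \<phi>" "v \<notin> set ys" for v
    using fv_inst_subsetD(1)[OF fv_inst that] .
  have fv_y: "\<eta> v \<in> B \<union> C" if "v \<in> fv \<phi>" "v \<in> set ys" for v
    using fv_inst_subsetD(2)[OF fv_inst that] .
  \<comment> \<open>This links parameters to shifted variables. It is used once to make
    \<open>\<rho>'\<close> out of \<open>\<rho>\<close>, and once with a single assignment in both
    roles.\<close>
  have sat_inst: "sat M (case_sum \<rho> id) [] (inst ys \<eta> \<phi>) \<longleftrightarrow> sat M \<rho>' [] (rename \<sigma> \<phi>)"
    if "\<And>v. v \<in> set ?xs \<Longrightarrow> \<rho>' v = \<rho> v" "\<And>v. v \<in> set ys \<Longrightarrow> v \<in> fv \<phi> \<Longrightarrow> \<rho>' (\<sigma> v) = \<eta> v" for \<rho> \<rho>'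
    unfolding inst_def sat_rename
    by (rule sat_cong) (use that fv_x in \<open>auto simp: \<sigma>_def\<close>)
  show "\<exists>as bs cs \<phi> xs ys zs. set as \<subseteq> A \<and> set bs \<subseteq> B \<and> set cs \<subseteq> C \<and>
        length xs = length as \<and> length ys = length bs \<and> length zs = length cs \<and>
        distinct (xs @ ys @ zs) \<and>
        \<phi> \<in> formulas L \<and> fv \<phi> \<subseteq> set (xs @ ys @ zs) \<and>
        holds M \<phi> (xs @ ys @ zs) (as @ bs @ cs) \<and>
        (\<forall>as'. holds M \<phi> (xs @ ys @ zs) (as' @ bs @ cs) \<longrightarrow> \<not> indep L M \<Omega> (set as') C (set bs))"
  proof (intro exI conjI allI impI)
    show "set as \<subseteq> A" by (rule as)
    show "set (map \<eta> vB) \<subseteq> B" by (auto simp: vB_def)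
    show "set (map \<eta> vC) \<subseteq> C" using fv_y by (auto simp: vC_def vs_def)
    show "length ?xs = length as" "length (map \<sigma> vB) = length (map \<eta> vB)"
      "length (map \<sigma> vC) = length (map \<eta> vC)" by simp_all
    have "distinct (vB @ vC)" using set_vs by (auto simp: vB_def vC_def vs_def)
    moreover have "inj_on \<sigma> (set (vB @ vC))" using set_vs inj by (auto intro: inj_on_subset)
    ultimately have "distinct (map \<sigma> vB @ map \<sigma> vC)"
      by (metis distinct_map map_append)
    moreover have "set ?xs \<inter> set (map \<sigma> vB @ map \<sigma> vC) = {}"
      using small_index set_vs(1) by (fastforce simp: \<sigma>_def)
    ultimately show "distinct (?xs @ map \<sigma> vB @ map \<sigma> vC)"
      using distinct_tp_vars by (simp add: Int_Un_distrib)
    show "rename \<sigma> \<phi> \<in> formulas L"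
      using wf_fm_rename[OF \<phi>, of fst \<sigma>] by (simp add: formulas_def \<sigma>_def)
    show "fv (rename \<sigma> \<phi>) \<subseteq> set (?xs @ map \<sigma> vB @ map \<sigma> vC)"
    proof
      fix w assume "w \<in> fv (rename \<sigma> \<phi>)"
      then obtain v where v: "v \<in> fv \<phi>" "w = \<sigma> v" by (auto simp: fm.set_map)
      show "w \<in> set (?xs @ map \<sigma> vB @ map \<sigma> vC)"
      proof (cases "v \<in> set ys")
        case True
        then show ?thesis using v set_vs(1) by auto
      next
        case False
        then show ?thesis using v fv_x[of v] by (simp add: \<sigma>_def)
      qed
    qed
    obtain \<rho> where \<rho>: "assignment M \<rho>" "map \<rho> ?xs = as" "sat M (case_sum \<rho> id) [] (inst ys \<eta> \<phi>)"
      using holds_inst by (auto simp: holds_par_def)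
    \<comment> \<open>\<open>\<rho>'\<close> undoes the shift on the images of \<open>ys\<close> and
      keeps \<open>\<rho>\<close> elsewhere. The guard \<open>snd w \<ge> ?N\<close> protects the
      variables in \<open>?xs\<close> from truncated subtraction.\<close>
    define \<rho>' where "\<rho>' = (\<lambda>w. if snd w \<ge> ?N \<and> (fst w, snd w - ?N) \<in> set ys
      then \<eta> (fst w, snd w - ?N) else \<rho> w)"
    have \<rho>'_x: "\<rho>' v = \<rho> v" if "v \<in> set ?xs" for v
      using small_index[OF that] by (simp add: \<rho>'_def)
    have \<rho>'_y: "\<rho>' (\<sigma> v) = \<eta> v" if "v \<in> set ys" for v
      using that by (simp add: \<rho>'_def \<sigma>_def)
    have "assignment M \<rho>'"
      using \<rho>(1) \<eta> by (auto simp: assignment_def \<rho>'_def)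
    moreover have "map \<rho>' (?xs @ map \<sigma> vB @ map \<sigma> vC) = as @ map \<eta> vB @ map \<eta> vC"
    proof -
      have "\<rho>' (\<sigma> v) = \<eta> v" if "v \<in> set vB \<union> set vC" for v
        using that set_vs(1) \<rho>'_y by blast
      then have "map \<rho>' ?xs = map \<rho> ?xs" "map \<rho>' (map \<sigma> vB) = map \<eta> vB"
          "map \<rho>' (map \<sigma> vC) = map \<eta> vC"
        using \<rho>'_x by simp_all
      then show ?thesis using \<rho>(2) by (simp only: map_append)
    qed
    moreover have "sat M \<rho>' [] (rename \<sigma> \<phi>)"
      using \<rho>(3) sat_inst \<rho>'_x \<rho>'_y by metis
    ultimately show "holds M (rename \<sigma> \<phi>) (?xs @ map \<sigma> vB @ map \<sigma> vC) (as @ map \<eta> vB @ map \<eta> vC)"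
      unfolding holds_def by blast
  next
    fix as'
    assume "holds M (rename \<sigma> \<phi>) (?xs @ map \<sigma> vB @ map \<sigma> vC) (as' @ map \<eta> vB @ map \<eta> vC)"
    then obtain \<rho> where \<rho>: "assignment M \<rho>" "sat M \<rho> [] (rename \<sigma> \<phi>)"
        and eq: "map \<rho> ?xs @ map \<rho> (map \<sigma> (vB @ vC)) = as' @ map \<eta> (vB @ vC)"
      by (auto simp: holds_def)
    \<comment> \<open>The trailing blocks have equal length, so the concatenations split at the same
      place; this also forces the length of \<open>as'\<close>.\<close>
    have as': "map \<rho> ?xs = as'" and y: "map \<rho> (map \<sigma> (vB @ vC)) = map \<eta> (vB @ vC)"
    proof -
      have "map \<rho> ?xs = as' \<and> map \<rho> (map \<sigma> (vB @ vC)) = map \<eta> (vB @ vC)"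
        using eq by (subst (asm) append_eq_append_conv) simp_all
      then show "map \<rho> ?xs = as'" "map \<rho> (map \<sigma> (vB @ vC)) = map \<eta> (vB @ vC)"
        by blast+
    qed
    have "map (sort_of M) as' = map (sort_of M) as"
      unfolding as'[symmetric] using \<rho>(1) by (auto intro!: nth_equalityI simp: assignment_def)
    then have vars: "tp_vars M as' = ?xs" by (rule tp_vars_cong)
    have "\<rho> (\<sigma> v) = \<eta> v" if "v \<in> set ys" "v \<in> fv \<phi>" for v
      using that y set_vs(1) by auto
    then have "sat M (case_sum \<rho> id) [] (inst ys \<eta> \<phi>)"
      using sat_inst \<rho>(2) by blast
    then have "holds_par M (inst ys \<eta> \<phi>) (tp_vars M as') as'"
      using \<rho>(1) as' unfolding holds_par_def vars by blast
    \<comment> \<open>A parameter in \<open>B\<close> is listed in \<open>map \<eta> vB\<close> and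
      any other lies in \<open>C\<close>, so the instance needs nothing else from
      \<open>B\<close>.\<close>
    moreover have "fv (inst ys \<eta> \<phi>) \<subseteq> Inl ` set ?xs \<union> Inr ` (set (map \<eta> vB) \<union> C)"
    proof
      fix w assume "w \<in> fv (inst ys \<eta> \<phi>)"
      then obtain v where v: "v \<in> fv \<phi>" "w = (if v \<in> set ys then Inr (\<eta> v) else Inl v)"
        by (auto simp: inst_def fm.set_map)
      then show "w \<in> Inl ` set ?xs \<union> Inr ` (set (map \<eta> vB) \<union> C)"
        using fv_x[of v] fv_y[of v] by (auto simp: vB_def vs_def)
    qed
    ultimately have "inst ys \<eta> \<phi> \<in> tp L M as' (set (map \<eta> vB) \<union> C)"
      using wf_inst by (simp add: tp_def par_formulas_def vars)
    then show "\<not> indep L M \<Omega> (set as') C (set (map \<eta> vB))"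
      using indepD[OF _ subset_refl pr \<eta> _ div] by blast
  qed
qed


section \<open>Independence from the base\<close>

text \<open>
  The tuple \<open>ys\<close> may have repetitions; a realisation of \<open>tp(\<eta>(ys)/C)\<close> repeats its entries in the
  same way because the type contains the corresponding equations between variables.
\<close>

lemma realises_tp_transfer:
  assumes \<eta>: "assignment M \<eta>" and b: "realises_tp L M b (map \<eta> ys) C"
  obtains \<eta>' where "assignment M \<eta>'" "map \<eta>' ys = b"
    "\<And>\<theta>. \<theta> \<in> par_formulas L M (set ys) C \<Longrightarrow> sat M (case_sum \<eta> id) [] \<theta> \<Longrightarrow>
      sat M (case_sum \<eta>' id) [] \<theta>"
proof -
  \<comment> \<open>\<open>j v\<close> is a chosen position of \<open>v\<close> in
    \<open>ys\<close>, so \<open>(fst v, j v)\<close> is the type variable that stands for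
    \<open>v\<close>.\<close>
  define j where "j v = (SOME i. i < length ys \<and> ys ! i = v)" for v
  have j: "j v < length ys" "ys ! j v = v" if "v \<in> set ys" for v
    using someI_ex[of "\<lambda>i. i < length ys \<and> ys ! i = v"] that
    by (auto simp: j_def in_set_conv_nth)
  let ?p = "tp_vars M (map \<eta> ys)"
  have sort_\<eta>: "sort_of M (\<eta> v) = fst v" for v
    using \<eta> unfolding assignment_def by blast
  have p_nth: "?p ! i = (fst (ys ! i), i)" if "i < length ys" for i
    using that by (simp add: sort_\<eta>)
  have p_set: "(fst (ys ! i), i) \<in> set ?p" if "i < length ys" for i
    using that p_nth nth_mem[of i ?p] by simp
  have sorts_b: "map (sort_of M) b = map fst ys"
    using b by (simp add: realises_tp_def sort_\<eta> o_def)
  then have len_b: "length b = length ys" by (metis length_map)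
  have sort_b: "sort_of M (b ! i) = fst (ys ! i)" if "i < length ys" for i
    using that sorts_b len_b by (metis nth_map)
  \<comment> \<open>\<open>\<rho>0\<close> gives the \<open>i\<close>-th type variable the value of
    the \<open>i\<close>-th entry of \<open>ys\<close>. Other variables default to
    \<open>\<eta>\<close>, which keeps the sorts right.\<close>
  obtain \<rho>0 where \<rho>0: "assignment M \<rho>0" "\<And>i. i < length ys \<Longrightarrow> \<rho>0 (fst (ys ! i), i) = \<eta> (ys ! i)"
  proof
    let ?r = "\<lambda>w. if snd w < length ys \<and> fst (ys ! snd w) = fst w then \<eta> (ys ! snd w) else \<eta> w"
    show "assignment M ?r" by (auto simp: assignment_def sort_\<eta>)
  qed simp
  have map_\<rho>0: "map \<rho>0 ?p = map \<eta> ys"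
    using \<rho>0(2) by (auto intro!: nth_equalityI simp: sort_\<eta>)
  have realised: "holds_par M \<theta> ?p b"
    if "wf_fm L (case_sum fst (sort_of M)) [] \<theta>" "fv \<theta> \<subseteq> Inl ` set ?p \<union> Inr ` C"
      "sat M (case_sum \<rho>0 id) [] \<theta>" for \<theta>
    using b that \<rho>0(1) map_\<rho>0 unfolding realises_tp_def tp_def par_formulas_def holds_par_def by blast
  have eval_p: "\<rho> (fst (ys ! i), i) = b ! i" if "map \<rho> ?p = b" "i < length ys" for \<rho> i
    using that p_nth by (metis length_map nth_map tp_vars_simps(1))
  have repeats: "b ! j (ys ! i) = b ! i" if i: "i < length ys" for i
  proof -
    let ?k = "j (ys ! i)"
    have k: "?k < length ys" "ys ! ?k = ys ! i" using j[of "ys ! i"] i by auto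
    let ?e = "Eq (Fv (Inl (fst (ys ! i), ?k))) (Fv (Inl (fst (ys ! i), i))) :: ('a, 'b, 'c, 'a var + 'd) fm"
    have "wf_tm L (case_sum fst (sort_of M)) [] (Fv (Inl (s, n))) s" for s and n :: nat
      using wf_tm.intros(1)[of L "case_sum fst (sort_of M)" "[]" "Inl (s, n)"] by simp
    then have "holds_par M ?e ?p b"
      using p_set[OF i] p_set[OF k(1)] \<rho>0(2)[OF i] \<rho>0(2)[OF k(1)] k(2)
      by (intro realised) auto
    then obtain \<rho> where \<rho>: "map \<rho> ?p = b" "\<rho> (fst (ys ! i), ?k) = \<rho> (fst (ys ! i), i)"
      by (auto simp: holds_par_def)
    then show ?thesis
      using eval_p[OF \<rho>(1) i] eval_p[OF \<rho>(1) k(1)] k(2) by simp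
  qed
  \<comment> \<open>By \<open>repeats\<close>, the entry of \<open>b\<close> at the chosen position
    of \<open>v\<close> is its entry at every position of \<open>v\<close>.\<close>
  define \<eta>' where "\<eta>' v = (if v \<in> set ys then b ! j v else \<eta> v)" for v
  show thesis
  proof
    show "assignment M \<eta>'"
      using j sort_b by (simp add: assignment_def \<eta>'_def sort_\<eta>)
    show "map \<eta>' ys = b"
      using repeats len_b by (auto intro!: nth_equalityI simp: \<eta>'_def)
  next
    fix \<theta> assume \<theta>: "\<theta> \<in> par_formulas L M (set ys) C" "sat M (case_sum \<eta> id) [] \<theta>"
    then have wf: "wf_fm L (case_sum fst (sort_of M)) [] \<theta>" and fv: "fv \<theta> \<subseteq> Inl ` set ys \<union> Inr ` C"
      by (auto simp: par_formulas_def)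
    \<comment> \<open>\<open>f\<close> rewrites a formula in \<open>ys\<close> in the type
      variables: under \<open>\<rho>0\<close> it is read as under \<open>\<eta>\<close>, and under
      an assignment realising \<open>b\<close> as under \<open>\<eta>'\<close>.\<close>
    define f where "f = map_sum (\<lambda>v. (fst v, j v)) (id :: 'd \<Rightarrow> 'd)"
    have "holds_par M (rename f \<theta>) ?p b"
    proof (rule realised)
      show "wf_fm L (case_sum fst (sort_of M)) [] (rename f \<theta>)"
        using wf by (rule wf_fm_rename) (auto simp: f_def split: sum.splits)
      show "fv (rename f \<theta>) \<subseteq> Inl ` set ?p \<union> Inr ` C"
      proof
        fix w assume "w \<in> fv (rename f \<theta>)"
        then obtain u where u: "u \<in> fv \<theta>" "w = f u" by (auto simp: fm.set_map)
        show "w \<in> Inl ` set ?p \<union> Inr ` C"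
        proof (cases u)
          case (Inl v)
          then have "v \<in> set ys" using u fv by auto
          then show ?thesis using j[of v] p_set[of "j v"] u Inl by (simp add: f_def)
        next
          case (Inr c)
          then show ?thesis using u fv by (auto simp: f_def)
        qed
      qed
      have "sat M (case_sum \<rho>0 id \<circ> f) [] \<theta> \<longleftrightarrow> sat M (case_sum \<eta> id) [] \<theta>"
      proof (rule sat_cong)
        fix u assume u: "u \<in> fv \<theta>"
        show "(case_sum \<rho>0 id \<circ> f) u = case_sum \<eta> id u"
        proof (cases u)
          case (Inl v)
          then have "v \<in> set ys" using u fv by auto
          then show ?thesis using j[of v] \<rho>0(2)[of "j v"] Inl by (simp add: f_def)
        qed (simp add: f_def)
      qed
      then show "sat M (case_sum \<rho>0 id) [] (rename f \<theta>)"
        using \<theta>(2) by (simp add: sat_rename)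
    qed
    then obtain \<rho> where \<rho>: "map \<rho> ?p = b" "sat M (case_sum \<rho> id \<circ> f) [] \<theta>"
      by (auto simp: holds_par_def sat_rename)
    have "sat M (case_sum \<rho> id \<circ> f) [] \<theta> \<longleftrightarrow> sat M (case_sum \<eta>' id) [] \<theta>"
    proof (rule sat_cong)
      fix u assume u: "u \<in> fv \<theta>"
      show "(case_sum \<rho> id \<circ> f) u = case_sum \<eta>' id u"
      proof (cases u)
        case (Inl v)
        then have "v \<in> set ys" using u fv by auto
        then show ?thesis using j[of v] eval_p[OF \<rho>(1), of "j v"] Inl by (simp add: f_def \<eta>'_def)
      qed (simp add: f_def)
    qed
    with \<rho>(2) show "sat M (case_sum \<eta>' id) [] \<theta>" by simp
  qed
qed

text \<open>If \<open>A \<subseteq> C\<close>, then \<open>\<phi>\<close> with the values of its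
  other variables plugged in is a formula in \<open>ys\<close> over \<open>C\<close>, so it passes
  to every conjugate. If \<open>B \<subseteq> C\<close>, every conjugate agrees with the original
  tuple at the variables of \<open>ys\<close> occurring in \<open>\<phi>\<close>.\<close>

lemma indep_if_over_base:
  assumes \<Omega>: "\<Omega> \<subseteq> Xi L M" and AB: "A \<subseteq> C \<or> B \<subseteq> C"
  shows "indep L M \<Omega> A C B"
proof (rule indepI)
  fix as \<phi> xs ys \<psi> yss \<eta>0
  assume as: "set as \<subseteq> A" and pr: "((\<phi>, xs, ys), (\<psi>, yss)) \<in> \<Omega>"
    and \<eta>0: "\<And>v. v \<in> set ys \<Longrightarrow> sort_of M (\<eta>0 v) = fst v"
    and tp: "inst ys \<eta>0 \<phi> \<in> tp L M as (B \<union> C)"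
    and div: "formula_divides L M ((\<phi>, xs, ys), (\<psi>, yss)) (map \<eta>0 ys) C"
  have xi: "((\<phi>, xs, ys), (\<psi>, yss)) \<in> Xi L M" using pr \<Omega> by auto
  have wf: "wf_fm L fst [] \<phi>" and disj: "set xs \<inter> set ys = {}"
    and wit: "inconsistency_witness M ((\<phi>, xs, ys), (\<psi>, yss))"
    using xi by (auto simp: Xi_def formulas_def)
  obtain b :: "nat \<Rightarrow> _" where b: "\<And>i. realises_tp L M (b i) (map \<eta>0 ys) C"
    and \<psi>: "\<And>is. length is = length yss \<Longrightarrow> sorted_wrt (<) is \<Longrightarrow>
      holds M \<psi> (concat yss) (concat (map b is))"
    using formula_dividesE[OF div] by blast
  have fv_inst: "fv (inst ys \<eta>0 \<phi>) \<subseteq> Inl ` set (tp_vars M as) \<union> Inr ` (B \<union> C)"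
    and "holds_par M (inst ys \<eta>0 \<phi>) (tp_vars M as) as"
    using tp by (auto simp: tp_def par_formulas_def)
  then obtain \<rho> where \<rho>: "assignment M \<rho>" "map \<rho> (tp_vars M as) = as"
      "sat M (case_sum \<rho> id) [] (inst ys \<eta>0 \<phi>)"
    by (auto simp: holds_par_def)
  \<comment> \<open>One assignment reads the instance as plain \<open>\<phi>\<close>:
    \<open>\<eta>0\<close> supplies the parameters on \<open>ys\<close>, and \<open>\<rho>\<close>
    the remaining values.\<close>
  define \<eta> where "\<eta> v = (if v \<in> set ys then \<eta>0 v else \<rho> v)" for v
  have \<eta>: "assignment M \<eta>" using \<rho>(1) \<eta>0 by (simp add: \<eta>_def assignment_def)
  have map_\<eta>: "map \<eta> ys = map \<eta>0 ys" by (simp add: \<eta>_def)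
  have "case_sum \<rho> id \<circ> (\<lambda>v. if v \<in> set ys then Inr (\<eta>0 v) else Inl v) = \<eta>"
    by (auto simp: \<eta>_def)
  then have sat_\<phi>: "sat M \<eta> [] \<phi>" using \<rho>(3) by (simp add: inst_def sat_rename)
  have fv_x: "\<eta> v \<in> A" if "v \<in> fv \<phi>" "v \<notin> set ys" for v
  proof -
    have "v \<in> set (tp_vars M as)"
      using fv_inst_subsetD(1)[OF fv_inst that] .
    then have "\<rho> v \<in> set as" using \<rho>(2) by (metis image_eqI set_map)
    then show ?thesis using as that by (auto simp: \<eta>_def)
  qed
  have fv_y: "\<eta> v \<in> B \<union> C" if "v \<in> fv \<phi>" "v \<in> set ys" for v
    using fv_inst_subsetD(2)[OF fv_inst that] that by (simp add: \<eta>_def)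
  \<comment> \<open>The tuple \<open>map \<eta> xs\<close> is the same for all \<open>i\<close>;
    this common solution is what contradicts the inconsistency witness.\<close>
  have "holds M \<phi> (xs @ ys) (map \<eta> xs @ b i)" for i
  proof -
    have "realises_tp L M (b i) (map \<eta> ys) C" by (simp only: map_\<eta> b)
    from realises_tp_transfer[OF \<eta> this] obtain \<eta>' where \<eta>': "assignment M \<eta>'" "map \<eta>' ys = b i"
      and transfer: "\<And>\<theta>. \<theta> \<in> par_formulas L M (set ys) C \<Longrightarrow> sat M (case_sum \<eta> id) [] \<theta> \<Longrightarrow>
        sat M (case_sum \<eta>' id) [] \<theta>"
      by blast
    define \<zeta> where "\<zeta> v = (if v \<in> set ys then \<eta>' v else \<eta> v)" for v
    have "assignment M \<zeta>" using \<eta> \<eta>'(1) by (simp add: \<zeta>_def assignment_def)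
    moreover have "map \<zeta> (xs @ ys) = map \<eta> xs @ b i"
    proof -
      have "map \<zeta> xs = map \<eta> xs" "map \<zeta> ys = map \<eta>' ys"
        using disj by (auto simp: \<zeta>_def)
      then show ?thesis using \<eta>'(2) by simp
    qed
    moreover have "sat M \<zeta> [] \<phi>"
      using AB
    proof
      assume A: "A \<subseteq> C"
      \<comment> \<open>The variables outside \<open>ys\<close> become parameters; those that occur
        have values in \<open>A\<close>, hence in \<open>C\<close>.\<close>
      define f where "f v = (if v \<in> set ys then Inl v else Inr (\<eta> v))" for v
      have "wf_fm L (case_sum fst (sort_of M)) [] (rename f \<phi>)"
        using wf by (rule wf_fm_rename) (use \<eta> in \<open>auto simp: f_def assignment_def\<close>)
      moreover have "f v \<in> Inl ` set ys \<union> Inr ` C" if "v \<in> fv \<phi>" for v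
        using fv_x[OF that] A by (auto simp: f_def)
      ultimately have "rename f \<phi> \<in> par_formulas L M (set ys) C"
        by (simp add: par_formulas_def fm.set_map image_subset_iff)
      moreover have "case_sum \<eta> id \<circ> f = \<eta>" "case_sum \<eta>' id \<circ> f = \<zeta>"
        by (auto simp: f_def \<zeta>_def)
      ultimately show ?thesis
        using transfer[of "rename f \<phi>"] sat_\<phi> by (simp add: sat_rename)
    next
      assume B: "B \<subseteq> C"
      have "\<zeta> v = \<eta> v" if "v \<in> fv \<phi>" for v
      proof (cases "v \<in> set ys")
        case True
        \<comment> \<open>The equation of \<open>v\<close> with its value is a formula over
          \<open>C\<close>, so every conjugate keeps that value.\<close>
        let ?e = "Eq (Fv (Inl v)) (Fv (Inr (\<eta> v))) :: ('a, 'b, 'c, 'a var + 'd) fm"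
        have "sort_of M (\<eta> v) = fst v"
          using \<eta> unfolding assignment_def by blast
        then have "wf_tm L (case_sum fst (sort_of M)) [] (Fv (Inl v)) (fst v)"
          "wf_tm L (case_sum fst (sort_of M)) [] (Fv (Inr (\<eta> v))) (fst v)"
          using wf_tm.intros(1)[of L "case_sum fst (sort_of M)" "[]" "Inl v"]
            wf_tm.intros(1)[of L "case_sum fst (sort_of M)" "[]" "Inr (\<eta> v)"]
          by simp_all
        moreover have "\<eta> v \<in> C" using fv_y[OF that True] B by auto
        ultimately have "?e \<in> par_formulas L M (set ys) C"
          using True by (auto simp: par_formulas_def)
        then show ?thesis using transfer[of ?e] True by (simp add: \<zeta>_def)
      qed (simp add: \<zeta>_def)
      then show ?thesis using sat_\<phi> sat_cong[of \<phi> \<zeta> \<eta>] by simp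
    qed
    ultimately show ?thesis unfolding holds_def by blast
  qed
  \<comment> \<open>The first \<open>length yss\<close> terms of the sequence suffice. If
    \<open>yss\<close> is empty, so is the list of terms, and \<open>map \<eta> xs\<close> with the
    truth of \<open>\<psi>\<close> still gives the contradiction.\<close>
  moreover have "holds M \<psi> (concat yss) (concat (map b [0..<length yss]))"
    by (rule \<psi>) (simp_all add: sorted_wrt_upt)
  ultimately show False
    using wit unfolding inconsistency_witness_def
    by (auto dest!: spec[of _ "map \<eta> xs"] spec[of _ "map b [0..<length yss]"])
qed

theorem proposition2p12:
  fixes L :: "('s, 'f, 'r) signature"
    and T :: "('s, 'f, 'r, 's var) fm set"
    and M :: "('s, 'f, 'r, 'm) struct"
    and \<kappa> :: "'k rel"
    and \<Omega> :: "('s, 'f, 'r) inc_pair set"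
  assumes "complete_theory L T"
    and "big_model L T \<kappa> M"
    and "\<Omega> \<subseteq> Xi L M"
    and "closed_under_variable_substitution \<Omega>"
  shows "invariance L M \<kappa> (indep L M \<Omega>) \<and>
    monotonicity \<kappa> (indep L M \<Omega>) \<and>
    base_monotonicity \<kappa> (indep L M \<Omega>) \<and>
    finite_character \<kappa> (indep L M \<Omega>) \<and>
    strong_finite_character L M \<kappa> (indep L M \<Omega>) \<and>
    (\<forall>A B. small \<kappa> A \<and> small \<kappa> B \<longrightarrow> indep L M \<Omega> A B B \<and> indep L M \<Omega> A A B)"
proof -
  have M: "is_structure L M"
    using assms(2) by (simp add: big_model_def is_model_def)
  \<comment> \<open>The last two claims are the cases of \<open>indep_if_over_base\<close> in which
    the base equals the right or the left set.\<close>
  show ?thesis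
    using invariance_indep[OF M assms(3)] monotonicity_indep base_monotonicity_indep
      finite_character_indep strong_finite_character_indep[OF assms(3)]
      indep_if_over_base[OF assms(3)]
    by blast
qed

end
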